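(* Let $n>0$ be an odd integer. The trapezoidal quadratures $$\int_0^{2\pi}p(x)\,dx=\frac{2\pi}{n}\sum_{j=0}^{n-1}p(x_j)\quad\text{for all }p\in T_{n-1},\qquad x_{j+1}-x_j=\frac{2\pi}{n}\ (0\le j\le n-2),$$ are equivalent to the symmetric bilinear quadratures of order $(n,n)$ that are exact on $T_{(n-1)/2}\times T_{(n-1)/2}$ for the $L^2(0,2\pi)$ inner product and are minimal on $\operatorname{span}\{\sin\tfrac{(n+1)x}{2},\cos\tfrac{(n+1)x}{2}\}$. That is, a symmetric bilinear quadrature $Q$ of order $(n,n)$ exact on $T_{(n-1)/2}\times T_{(n-1)/2}$ is minimal on $\operatorname{span}\{\sin\tfrac{(n+1)x}{2},\cos\tfrac{(n+1)x}{2}\}$ if and only if, up to reordering of its points, it is of the form $Q(f,g)=\frac{2\pi}{n}\sum_{j=0}^{n-1}f(x_j)g(x_j)$ with $x_{j+1}-x_j=\frac{2\pi}{n}$ in $\mathbb{R}/2\pi\mathbb{Z}$ for $0\le j\le n-2$.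
   Context: $T_k=\operatorname{span}\{1,\sin x,\dots,\sin kx,\cos x,\dots,\cos kx\}$ is the space of real trigonometric polynomials of degree at most $k$, regarded as functions on the circle $\mathbb{R}/2\pi\mathbb{Z}$. A symmetric bilinear quadrature of order $(n,n)$ is a bilinear form $Q(f,g)=f(\mathbf{x})^{*}Wg(\mathbf{x})$ on functions on $\mathbb{R}/2\pi\mathbb{Z}$, given by $n$ points $\mathbf{x}$ in $\mathbb{R}/2\pi\mathbb{Z}$ (the same points for $f$ and $g$) and a matrix $W\in\mathbb{R}^{n\times n}$, where $f(\mathbf{x})\in\mathbb{R}^n$ is the column vector of values of $f$ at the points and $^{*}$ is transpose. It is exact on $T_k\times T_k$ if $Q(f,g)=\int_0^{2\pi}f(x)g(x)\,dx$ for all $f,g\in T_k$. Let $k=(n-1)/2$ and let $\mathcal{Q}$ be the set of all symmetric bilinear quadratures of order $(n,n)$ exact on $T_k\times T_k$. For a finite-dimensional space $\mathcal{G}_1$ of continuous functions that are $L^2(0,2\pi)$-orthogonal to $T_k$, $Q\in\mathcal{Q}$ is minimal on $\mathcal{G}_1$ if it minimizes over $\mathcal{Q}$ the quantity $$\sigma(Q)=\max_{0\ne f\in T_k,\ 0\ne g\in\mathcal{G}_1}\frac{|Q(f,g)|}{\|f\|_{L^2(0,2\pi)}\|g\|_{L^2(0,2\pi)}}.$$ A classical quadrature $q(h)=\sum_jw_jh(x_j)$ corresponds to the symmetric bilinear quadrature $Q(f,g)=q(fg)$, whose matrix $W$ is diagonal with entries $w_j$. *)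

theory Defs
  imports "HOL-Analysis.Analysis" "HOL-Library.Function_Algebras" "HOL-Library.Periodic_Fun"
begin

text \<open>
  Functions on the circle \<open>\<real>/2\<pi>\<int>\<close> are represented by \<open>2\<pi>\<close>-periodic functions on the reals, and
  points of the circle by arbitrary real representatives. The type \<^typ>\<open>real \<Rightarrow> real\<close> is not an
  instance of \<^class>\<open>real_vector\<close>, hence the interpretation with explicit pointwise scaling.
\<close>

interpretation fspace: vector_space "\<lambda>(c::real) (f::real \<Rightarrow> real) x. c * f x"
  by unfold_locales (auto simp: fun_eq_iff algebra_simps)

definition trig_polys :: "nat \<Rightarrow> (real \<Rightarrow> real) set" where
  "trig_polys k =
     fspace.span ({\<lambda>x. 1} \<union> {\<lambda>x. sin (real j * x) | j. j \<in> {1..k}}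
                          \<union> {\<lambda>x. cos (real j * x) | j. j \<in> {1..k}})"

definition L2norm :: "(real \<Rightarrow> real) \<Rightarrow> real" where
  "L2norm f = sqrt (integral {0..2*pi} (\<lambda>x. (f x)\<^sup>2))"

text \<open>
  A symmetric bilinear quadrature of order \<open>(n,n)\<close> is given by its points \<open>x\<close> and its matrix \<open>W\<close>,
  where \<open>n = CARD('n)\<close>. As in the mathematical definition, neither distinctness of the points nor
  symmetry of \<open>W\<close> is required: "symmetric" means that both arguments use the same points.
\<close>

definition bilinear_quad ::
    "real ^ 'n \<Rightarrow> real ^ 'n ^ 'n \<Rightarrow> (real \<Rightarrow> real) \<Rightarrow> (real \<Rightarrow> real) \<Rightarrow> real" where
  "bilinear_quad x W f g = (\<chi> i. f (x $ i)) \<bullet> (W *v (\<chi> i. g (x $ i)))"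

definition exact_quads :: "nat \<Rightarrow> ((real ^ 'n) \<times> (real ^ 'n ^ 'n)) set" where
  "exact_quads k =
     {(x, W). \<forall>f\<in>trig_polys k. \<forall>g\<in>trig_polys k.
        bilinear_quad x W f g = integral {0..2*pi} (\<lambda>t. f t * g t)}"

text \<open>
  For a nonzero finite-dimensional space \<open>G\<close> of continuous functions on the circle, the supremum
  below is attained, because the quotient is invariant under scaling of \<open>f\<close> and \<open>g\<close>.
\<close>

definition quad_sigma ::
    "nat \<Rightarrow> (real \<Rightarrow> real) set \<Rightarrow> real ^ 'n \<Rightarrow> real ^ 'n ^ 'n \<Rightarrow> real" where
  "quad_sigma k G x W =
     Sup {\<bar>bilinear_quad x W f g\<bar> / (L2norm f * L2norm g) | f g.
            f \<in> trig_polys k \<and> f \<noteq> 0 \<and> g \<in> G \<and> g \<noteq> 0}"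

definition minimal_quad ::
    "nat \<Rightarrow> (real \<Rightarrow> real) set \<Rightarrow> real ^ 'n \<Rightarrow> real ^ 'n ^ 'n \<Rightarrow> bool" where
  "minimal_quad k G x W \<longleftrightarrow>
     (x, W) \<in> exact_quads k \<and>
     (\<forall>(y :: real ^ 'n, V) \<in> exact_quads k. quad_sigma k G x W \<le> quad_sigma k G y V)"

definition equispaced :: "nat \<Rightarrow> (nat \<Rightarrow> real) \<Rightarrow> bool" where
  "equispaced n x \<longleftrightarrow>
     (\<forall>j. j + 1 < n \<longrightarrow> (\<exists>m::int. x (j + 1) - x j = 2 * pi / real n + 2 * pi * of_int m))"

definition trapezoidal_sum :: "nat \<Rightarrow> (nat \<Rightarrow> real) \<Rightarrow> (real \<Rightarrow> real) \<Rightarrow> real" where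
  "trapezoidal_sum n x h = 2 * pi / real n * (\<Sum>j<n. h (x j))"

text \<open>
  The bijection \<open>p\<close> is the reordering of the points. The quadrature is compared with the trapezoidal
  one as a bilinear form on all functions on the circle, not only on trigonometric polynomials.
\<close>

definition is_trapezoidal :: "real ^ 'n \<Rightarrow> real ^ 'n ^ 'n \<Rightarrow> bool" where
  "is_trapezoidal x W \<longleftrightarrow>
     (\<exists>p. bij_betw p {..<CARD('n)} (UNIV :: 'n set) \<and>
          equispaced CARD('n) (\<lambda>j. x $ p j) \<and>
          (\<forall>f g. periodic_fun_simple f (2*pi) \<longrightarrow> periodic_fun_simple g (2*pi) \<longrightarrow>
             bilinear_quad x W f g =
               trapezoidal_sum CARD('n) (\<lambda>j. x $ p j) (\<lambda>t. f t * g t)))"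

end

theory Submission
  imports Defs
begin

text \<open>
  Put \<open>n = 2k + 1\<close> and \<open>m = k + 1\<close>. Exactness turns \<open>Q\<close> into the \<open>L\<^sup>2\<close> inner product of
  interpolants: since \<open>Q\<close> only sees values at the nodes, \<open>Q(f, g)\<close> is the integral of \<open>f\<close> against
  the unique element of \<open>T\<^sub>k\<close> that agrees with \<open>g\<close> at the nodes. That this interpolant exists, and
  that the nodes are distinct on the circle, is itself a consequence of exactness
  (\<open>exact_quads_Lagrange\<close>): the product of the functions \<open>sin ((t - x\<^sub>j) / 2)\<close> over the nodes
  \<open>j \<noteq> i\<close> lies in \<open>T\<^sub>k\<close> and would have \<open>L\<^sup>2\<close> norm \<open>0\<close> if it vanished at the node \<open>x\<^sub>i\<close> too. Hence
  \<open>\<sigma>(Q)\<close> is the norm of interpolation as an operator from the span of \<open>cos mt\<close> and \<open>sin mt\<close>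
  to \<open>T\<^sub>k\<close>.

  Let \<open>A\<close> and \<open>B\<close> be the interpolants of \<open>cos mt\<close> and \<open>sin mt\<close>. Write \<open>z\<close> for \<open>e\<^sup>i\<^sup>t\<close>
  and \<open>z\<^sub>j\<close> for its value at the node \<open>x\<^sub>j\<close>. The function \<open>A + iB\<close> is \<open>z\<close> to the power \<open>-k\<close> times a polynomial \<open>p\<close> of degree at most
  \<open>2k\<close> with \<open>p(z\<^sub>j) = z\<^sub>j\<^sup>n\<close> at all nodes, so that \<open>p(z) = z\<^sup>n - \<Prod>\<^sub>j (z - z\<^sub>j)\<close>. Its constant
  coefficient is, up to sign, the product of the \<open>z\<^sub>j\<close> and has modulus \<open>1\<close>. By Parseval the squared norms
  of \<open>A\<close> and \<open>B\<close> add up to at least \<open>2\<pi>\<close>; both are at most \<open>\<pi>\<sigma>(Q)\<^sup>2\<close>, whence \<open>\<sigma>(Q) \<ge> 1\<close>.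
  Equality forces \<open>p\<close> to be a constant \<open>c\<close>. Then all nodes are \<open>n\<close>-th roots of \<open>c\<close>, that is, they are
  equispaced, and an exact quadrature with equispaced nodes must coincide with the trapezoidal
  one (\<open>sigma_ge_sigma_min\<close>, \<open>sigma_eq_min_imp_trapezoidal\<close>).

  Conversely, on an equispaced grid a wave of frequency \<open>k + 1\<close> is indistinguishable from
  a wave of frequency \<open>k\<close> with the same amplitude (\<open>trapezoidal_alias\<close>). For \<open>k > 0\<close> the two waves have
  the same norm, so \<open>\<sigma> = 1\<close>. The case \<open>k = 0\<close> is degenerate: the alias
  is a constant, the optimal value is \<open>\<surd>2\<close>, and every exact quadrature attains it.
\<close>

section \<open>Trigonometric polynomials as Laurent polynomials\<close>

text \<open>
  In the variable \<open>z = e\<^sup>i\<^sup>t\<close> this is \<open>p(z)\<close> divided by \<open>z\<^sup>k\<close>. For \<open>degree p \<le> 2 * k\<close> its exponents run from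
  \<open>-k\<close> to \<open>k\<close>, so the elements of \<open>T\<^sub>k\<close> are the real-valued functions of this form, and root counting
  and products can be done with ordinary polynomials.
\<close>

definition laurent :: "nat \<Rightarrow> complex poly \<Rightarrow> real \<Rightarrow> complex" where
  "laurent k p t = cis (- (real k * t)) * poly p (cis t)"

lemma trig_polys_const: "(\<lambda>t. 1) \<in> trig_polys k"
  unfolding trig_polys_def by (rule fspace.span_base) auto

lemma trig_polys_scale:
  "f \<in> trig_polys k \<Longrightarrow> (\<lambda>t. c * f t) \<in> trig_polys k"
  unfolding trig_polys_def by (rule fspace.span_scale)

lemma trig_polys_zero: "(\<lambda>t. 0) \<in> trig_polys k"
  using trig_polys_scale[OF trig_polys_const, of 0 k] by simp

lemma trig_polys_add:
  "f \<in> trig_polys k \<Longrightarrow> g \<in> trig_polys k \<Longrightarrow> (\<lambda>t. f t + g t) \<in> trig_polys k"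
  unfolding trig_polys_def by (drule (1) fspace.span_add) (simp add: plus_fun_def)

lemma trig_polys_sum:
  "finite A \<Longrightarrow> (\<And>i. i \<in> A \<Longrightarrow> f i \<in> trig_polys k) \<Longrightarrow> (\<lambda>t. \<Sum>i\<in>A. f i t) \<in> trig_polys k"
  by (induction A rule: finite_induct) (auto intro: trig_polys_zero trig_polys_add)

lemma trig_polys_cos:
  fixes m :: int assumes "\<bar>m\<bar> \<le> int k"
  shows "(\<lambda>t. cos (m * t)) \<in> trig_polys k"
proof -
  define j where "j = nat \<bar>m\<bar>"
  have "cos (m * t) = cos (real j * t)" for t :: real
    by (cases "m \<ge> 0") (auto simp: j_def)
  moreover have "(\<lambda>t. cos (real j * t)) \<in> trig_polys k"
  proof (cases "j = 0")
    case True then show ?thesis by (simp add: trig_polys_const)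
  next
    case False
    then have "j \<in> {1..k}" using assms by (auto simp: j_def)
    then show ?thesis unfolding trig_polys_def by (intro fspace.span_base) blast
  qed
  ultimately show ?thesis by simp
qed

lemma trig_polys_sin:
  fixes m :: int assumes "\<bar>m\<bar> \<le> int k"
  shows "(\<lambda>t. sin (m * t)) \<in> trig_polys k"
proof -
  define j where "j = nat \<bar>m\<bar>"
  have "sin (m * t) = of_int (sgn m) * sin (real j * t)" for t :: real
    by (cases m "0::int" rule: linorder_cases) (auto simp: j_def)
  moreover have "(\<lambda>t. sin (real j * t)) \<in> trig_polys k"
  proof (cases "j = 0")
    case True then show ?thesis by (simp add: trig_polys_zero)
  next
    case False
    then have "j \<in> {1..k}" using assms by (auto simp: j_def)
    then show ?thesis unfolding trig_polys_def by (intro fspace.span_base) blast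
  qed
  ultimately show ?thesis using trig_polys_scale by presburger
qed

text \<open>
  The constant function is covered by the cosine case with \<open>j = 0\<close>.
\<close>

lemma trig_polys_induct [consumes 1, case_names zero add scale cos sin]:
  assumes "f \<in> trig_polys k"
    and "P (\<lambda>t. 0)" and "\<And>f g. P f \<Longrightarrow> P g \<Longrightarrow> P (\<lambda>t. f t + g t)"
    and "\<And>c f. P f \<Longrightarrow> P (\<lambda>t. c * f t)"
    and "\<And>j. j \<le> k \<Longrightarrow> P (\<lambda>t. cos (real j * t))"
    and "\<And>j. j \<le> k \<Longrightarrow> P (\<lambda>t. sin (real j * t))"
  shows "P f"
  using assms(1) unfolding trig_polys_def
proof (rule fspace.span_induct)
  show "fspace.subspace (Collect P)"
    using assms(2-4) by (simp add: fspace.subspace_def zero_fun_def plus_fun_def)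
next
  fix g assume "g \<in> {\<lambda>x. 1} \<union> {\<lambda>x. sin (real j * x) |j. j \<in> {1..k}} \<union>
                {\<lambda>x. cos (real j * x) |j. j \<in> {1..k}}"
  moreover have "P (\<lambda>t. 1)" using assms(5)[of 0] by simp
  ultimately show "P g" using assms(5,6) by fastforce
qed

lemma laurent_add: "laurent k (p + q) t = laurent k p t + laurent k q t"
  by (simp add: laurent_def algebra_simps)

lemma laurent_smult: "laurent k (smult c p) t = c * laurent k p t"
  by (simp add: laurent_def)

lemma laurent_mult: "laurent (k + l) (p * q) t = laurent k p t * laurent l q t"
proof -
  have "cis (- (real (k + l) * t)) = cis (- (real k * t)) * cis (- (real l * t))"
    by (simp add: cis_mult algebra_simps)
  then show ?thesis by (simp add: laurent_def)
qed

lemma norm_laurent: "cmod (laurent k p t) = cmod (poly p (cis t))"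
  by (simp add: laurent_def norm_mult)

lemma laurent_monom: "laurent k (monom c j) t = c * cis ((real j - real k) * t)"
proof -
  have "cis ((real j - real k) * t) = cis (- (real k * t)) * cis t ^ j"
    by (simp add: Complex.DeMoivre cis_mult algebra_simps)
  then show ?thesis by (simp add: laurent_def poly_monom)
qed

lemma trig_polys_laurent:
  assumes "f \<in> trig_polys k"
  obtains p where "degree p \<le> 2 * k" "\<And>t. complex_of_real (f t) = laurent k p t"
proof -
  have "\<exists>p. degree p \<le> 2 * k \<and> (\<forall>t. complex_of_real (f t) = laurent k p t)"
    using assms
  proof (induction f rule: trig_polys_induct)
    case zero
    show ?case by (intro exI[of _ 0]) (simp add: laurent_def)
  next
    case (add f g)
    then obtain p q where "degree p \<le> 2 * k" "\<forall>t. complex_of_real (f t) = laurent k p t"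
      "degree q \<le> 2 * k" "\<forall>t. complex_of_real (g t) = laurent k q t" by blast
    then show ?case by (intro exI[of _ "p + q"]) (simp add: laurent_add degree_add_le)
  next
    case (scale c f)
    then obtain p where "degree p \<le> 2 * k" "\<forall>t. complex_of_real (f t) = laurent k p t" by blast
    then show ?case
      by (intro exI[of _ "smult (of_real c) p"]) (simp add: laurent_smult)
  next
    case (cos j)
    have "degree (monom (1/2::complex) (k + j) + monom (1/2) (k - j)) \<le> 2 * k"
      using cos by (intro degree_add_le order.trans[OF degree_monom_le]) auto
    moreover have "complex_of_real (cos (real j * t)) =
        laurent k (monom (1/2) (k + j) + monom (1/2) (k - j)) t" for t
      using cos by (simp add: laurent_add laurent_monom complex_eq_iff of_nat_diff)
    ultimately show ?case by blast
  next
    case (sin j)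
    have "degree (monom (-\<i>/2) (k + j) + monom (\<i>/2) (k - j)) \<le> 2 * k"
      using sin by (intro degree_add_le order.trans[OF degree_monom_le]) auto
    moreover have "complex_of_real (sin (real j * t)) =
        laurent k (monom (-\<i>/2) (k + j) + monom (\<i>/2) (k - j)) t" for t
      using sin by (simp add: laurent_add laurent_monom complex_eq_iff of_nat_diff)
    ultimately show ?case by blast
  qed
  with that show thesis by blast
qed

lemma laurent_as_sum:
  assumes "degree p \<le> N"
  shows "laurent k p t = (\<Sum>j\<le>N. coeff p j * cis ((real j - real k) * t))"
proof -
  have "laurent k p t = laurent k (\<Sum>j\<le>N. monom (coeff p j) j) t"
    using poly_as_sum_of_monoms'[OF assms] by simp
  also have "\<dots> = (\<Sum>j\<le>N. laurent k (monom (coeff p j) j) t)"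
    by (simp add: laurent_def poly_sum sum_distrib_left)
  finally show ?thesis by (simp add: laurent_monom)
qed

lemma Re_laurent_trig_polys:
  assumes "degree p \<le> 2 * k"
  shows "(\<lambda>t. Re (laurent k p t)) \<in> trig_polys k"
proof -
  have "(\<lambda>t. Re (laurent k p t)) = (\<lambda>t. \<Sum>j\<le>2*k. Re (coeff p j) * cos (of_int (int j - int k) * t)
      + (- Im (coeff p j)) * sin (of_int (int j - int k) * t))"
    by (simp add: laurent_as_sum[OF assms] algebra_simps fun_eq_iff)
  also have "\<dots> \<in> trig_polys k"
    by (intro trig_polys_sum trig_polys_add trig_polys_scale trig_polys_cos trig_polys_sin) auto
  finally show ?thesis .
qed

lemma laurent_trig_polys:
  assumes "degree p \<le> 2 * k" "\<And>t. complex_of_real (f t) = laurent k p t"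
  shows "f \<in> trig_polys k"
proof -
  have "f = (\<lambda>t. Re (laurent k p t))" using assms(2) by (metis Re_complex_of_real)
  then show ?thesis using Re_laurent_trig_polys[OF assms(1)] by simp
qed

lemma trig_polys_mult:
  assumes "f \<in> trig_polys k" "g \<in> trig_polys l"
  shows "(\<lambda>t. f t * g t) \<in> trig_polys (k + l)"
proof -
  from assms obtain p q where "degree p \<le> 2 * k" "\<And>t. complex_of_real (f t) = laurent k p t"
    "degree q \<le> 2 * l" "\<And>t. complex_of_real (g t) = laurent l q t"
    by (metis trig_polys_laurent)
  then show ?thesis
    by (intro laurent_trig_polys[of "p * q"] order.trans[OF degree_mult_le])
       (simp_all add: laurent_mult)
qed

lemma trig_polys_periodic:
  assumes "f \<in> trig_polys k"
  shows "periodic_fun_simple f (2 * pi)"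
proof
  fix t
  have "cos (real j * (t + 2 * pi)) = cos (real j * t)" "sin (real j * (t + 2 * pi)) = sin (real j * t)" for j
    using cos.plus_of_nat[of "real j * t" j] sin.plus_of_nat[of "real j * t" j]
    by (simp_all add: algebra_simps)
  with assms show "f (t + 2 * pi) = f t"
    by (induction f rule: trig_polys_induct) auto
qed

lemma trig_polys_continuous:
  assumes "f \<in> trig_polys k"
  shows "continuous_on S f"
  using assms by (induction f rule: trig_polys_induct) (auto intro!: continuous_intros)

section \<open>Parseval and the norms of trigonometric polynomials\<close>

lemma has_integral_cis_int:
  fixes m :: int
  shows "((\<lambda>t. cis (m * t)) has_integral (if m = 0 then 2 * pi else 0)) {0..2 * pi}"
proof (cases "m = 0")
  case True
  then show ?thesis using has_integral_const_real[of "1::complex" 0 "2*pi"]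
    by (simp add: scaleR_conv_of_real)
next
  case False
  have "((\<lambda>t. cis (m * t) / (\<i> * m)) has_vector_derivative cis (m * t)) (at t within S)" for t :: real and S
  proof -
    have "((\<lambda>t. exp (\<i> * m * of_real t) / (\<i> * m)) has_vector_derivative exp (\<i> * m * of_real t)) (at t within S)"
      using False by (auto intro!: derivative_eq_intros has_vector_derivative_real_field)
    then show ?thesis by (simp add: cis_conv_exp mult_ac)
  qed
  from fundamental_theorem_of_calculus[OF _ this, of 0 "2*pi"]
  have "((\<lambda>t. cis (m * t)) has_integral (cis (m * (2 * pi)) / (\<i> * m) - cis (m * 0) / (\<i> * m))) {0..2 * pi}"
    by simp
  moreover have "cis (m * (2 * pi)) = 1"
    using cis_multiple_2pi[of "of_int m"] by (simp add: mult_ac)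
  ultimately show ?thesis using False by simp
qed

text \<open>
  Expanding the squared modulus into a double sum, only the diagonal terms have a nonzero integral.
\<close>

lemma parseval_poly:
  assumes "degree p \<le> N"
  shows "((\<lambda>t. (cmod (poly p (cis t)))\<^sup>2) has_integral 2 * pi * (\<Sum>j\<le>N. (cmod (coeff p j))\<^sup>2)) {0..2 * pi}"
proof -
  define c where "c = (\<lambda>i j. coeff p i * cnj (coeff p j))"
  have "((\<lambda>t. \<Sum>i\<le>N. \<Sum>j\<le>N. c i j * cis (of_int (int i - int j) * t))
      has_integral (\<Sum>i\<le>N. \<Sum>j\<le>N. c i j * (if int i - int j = 0 then 2 * pi else 0))) {0..2 * pi}"
    by (intro has_integral_sum finite_atMost has_integral_mult_right has_integral_cis_int)
  moreover have "(\<Sum>i\<le>N. \<Sum>j\<le>N. c i j * cis (of_int (int i - int j) * t)) =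
      of_real ((cmod (poly p (cis t)))\<^sup>2)" for t
  proof -
    have p: "poly p (cis t) = (\<Sum>j\<le>N. coeff p j * cis (real j * t))"
      using laurent_as_sum[OF assms, of 0 t] by (simp add: laurent_def)
    have "cis (of_int (int i - int j) * t) = cis (real i * t) * cnj (cis (real j * t))" for i j
      by (simp add: cis_cnj cis_mult algebra_simps)
    then show ?thesis
      unfolding complex_norm_square p cnj_sum sum_product by (simp add: c_def mult_ac)
  qed
  moreover have "(\<Sum>i\<le>N. \<Sum>j\<le>N. c i j * (if int i - int j = 0 then 2 * pi else 0)) =
      of_real (2 * pi * (\<Sum>j\<le>N. (cmod (coeff p j))\<^sup>2))"
    by (simp add: c_def if_distrib sum.delta' sum_distrib_left complex_norm_square mult_ac cong: if_cong del: of_real_power)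
  ultimately have "((\<lambda>t. complex_of_real ((cmod (poly p (cis t)))\<^sup>2)) has_integral
      of_real (2 * pi * (\<Sum>j\<le>N. (cmod (coeff p j))\<^sup>2))) {0..2 * pi}"
    by simp
  from has_integral_linear[OF this bounded_linear_Re] show ?thesis
    by (simp add: o_def del: of_real_power)
qed

lemma integral_square_nonneg: "integral {0..2 * pi} (\<lambda>t. (f t)\<^sup>2) \<ge> (0 :: real)"
  by (cases "(\<lambda>t. (f t)\<^sup>2) integrable_on {0..2 * pi}")
     (auto intro: Henstock_Kurzweil_Integration.integral_nonneg simp: not_integrable_integral)

lemma L2norm_nonneg: "L2norm f \<ge> 0"
  by (simp add: L2norm_def integral_square_nonneg)

lemma L2norm_square: "(L2norm f)\<^sup>2 = integral {0..2 * pi} (\<lambda>t. (f t)\<^sup>2)"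
  by (simp add: L2norm_def integral_square_nonneg)

lemma laurent_L2norm:
  assumes "degree p \<le> N" "\<And>t. complex_of_real (f t) = laurent k p t"
  shows "(L2norm f)\<^sup>2 = 2 * pi * (\<Sum>j\<le>N. (cmod (coeff p j))\<^sup>2)"
proof -
  have "(f t)\<^sup>2 = (cmod (complex_of_real (f t)))\<^sup>2" for t by simp
  then have "(f t)\<^sup>2 = (cmod (poly p (cis t)))\<^sup>2" for t by (simp only: assms(2) norm_laurent)
  then show ?thesis unfolding L2norm_square using parseval_poly[OF assms(1)] by (simp add: integral_unique)
qed

lemma laurent_L2norm_pos:
  assumes "p \<noteq> 0" "\<And>t. complex_of_real (f t) = laurent k p t"
  shows "L2norm f > 0"
proof -
  have "(\<Sum>j\<le>degree p. (cmod (coeff p j))\<^sup>2) > 0"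
    using assms(1) by (intro sum_pos2[of _ "degree p"]) auto
  then have "(L2norm f)\<^sup>2 > 0" using laurent_L2norm[OF order_refl assms(2)] by simp
  then show ?thesis using L2norm_nonneg[of f] by (cases "L2norm f = 0") auto
qed

lemma trig_polys_L2norm_pos:
  assumes "f \<in> trig_polys k" "f \<noteq> 0"
  shows "L2norm f > 0"
proof -
  obtain p where p: "\<And>t. complex_of_real (f t) = laurent k p t"
    using trig_polys_laurent[OF assms(1)] by blast
  have "p \<noteq> 0"
  proof
    assume "p = 0"
    then have "f = 0" using p by (auto simp: laurent_def)
    with assms(2) show False ..
  qed
  then show ?thesis using laurent_L2norm_pos p by blast
qed

text \<open>
  The real functions of pure frequency \<open>m\<close>; the complex number \<open>w\<close> carries amplitude and phase, so that
  aliasing amounts to rotating and conjugating \<open>w\<close>.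
\<close>

definition wave :: "nat \<Rightarrow> complex \<Rightarrow> real \<Rightarrow> real" where
  "wave m w t = Re (w * cis (real m * t))"

lemma wave_cos_sin: "wave m w t = Re w * cos (real m * t) - Im w * sin (real m * t)"
  by (simp add: wave_def)

lemma wave_trig_polys: "m \<le> k \<Longrightarrow> wave m w \<in> trig_polys k"
proof -
  assume "m \<le> k"
  then have "(\<lambda>t. Re w * cos (of_int (int m) * t) + (- Im w) * sin (of_int (int m) * t)) \<in> trig_polys k"
    by (intro trig_polys_add trig_polys_scale trig_polys_cos trig_polys_sin) auto
  moreover have "wave m w = (\<lambda>t. Re w * cos (of_int (int m) * t) + (- Im w) * sin (of_int (int m) * t))"
    by (simp add: fun_eq_iff wave_cos_sin)
  ultimately show ?thesis by simp
qed

lemma L2norm_wave: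
  assumes "m > 0"
  shows "L2norm (wave m w) = sqrt pi * cmod w"
proof -
  have sq: "(wave m w t)\<^sup>2 = (cmod w)\<^sup>2 / 2 + Re (w\<^sup>2 / 2 * cis (of_int (2 * int m) * t))" for t
  proof -
    have "(Re z)\<^sup>2 = (cmod z)\<^sup>2 / 2 + Re (z\<^sup>2 / 2)" for z
      using cmod_power2[of z] by (simp add: power2_eq_square field_simps)
    from this[of "w * cis (real m * t)"] show ?thesis
      by (simp add: wave_def norm_mult power_mult_distrib Complex.DeMoivre mult_ac)
  qed
  have "((\<lambda>t. w\<^sup>2 / 2 * cis (of_int (2 * int m) * t)) has_integral
      w\<^sup>2 / 2 * (if 2 * int m = 0 then 2 * pi else 0)) {0..2 * pi}"
    by (intro has_integral_mult_right has_integral_cis_int)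
  from has_integral_linear[OF this bounded_linear_Re] assms
  have "((\<lambda>t. Re (w\<^sup>2 / 2 * cis (of_int (2 * int m) * t))) has_integral 0) {0..2 * pi}"
    by (simp only: o_def) simp
  moreover have "((\<lambda>t. (cmod w)\<^sup>2 / 2) has_integral pi * (cmod w)\<^sup>2) {0..2 * pi}"
    using has_integral_const_real[of "(cmod w)\<^sup>2 / 2" 0 "2 * pi"] by simp
  ultimately have "((\<lambda>t. (wave m w t)\<^sup>2) has_integral pi * (cmod w)\<^sup>2 + 0) {0..2 * pi}"
    unfolding sq by (intro has_integral_add)
  then show ?thesis by (simp add: L2norm_def integral_unique real_sqrt_mult)
qed

section \<open>Exactness of the trapezoidal rule\<close>

lemma cis_eq_iff_sin: "cis s = cis t \<longleftrightarrow> sin ((s - t) / 2) = 0"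
proof -
  define u d where "u = (s + t) / 2" and "d = (s - t) / 2"
  have "cis s - cis t = cis u * (cis d - cis (- d))"
    by (simp add: u_def d_def algebra_simps cis_mult) (simp add: field_simps)
  also have "cis d - cis (- d) = 2 * \<i> * sin d" by (simp add: complex_eq_iff)
  finally show ?thesis by (auto simp: d_def)
qed

text \<open>
  Successive terms differ by the factor \<open>q\<close>, an \<open>n\<close>-th root of unity other than \<open>1\<close>, so this is a geometric
  sum over all powers of \<open>q\<close>. Representatives of the points modulo \<open>2\<pi>\<close> do not matter because \<open>j\<close> is
  an integer.
\<close>

lemma cis_sum_equispaced:
  assumes "equispaced n x" "0 < j" "j < n"
  shows "(\<Sum>l<n. cis (real j * x l)) = 0"
proof -
  define q where "q = cis (2 * pi * real j / real n)"
  have pow: "l < n \<Longrightarrow> cis (real j * x l) = cis (real j * x 0) * q ^ l" for l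
  proof (induction l)
    case (Suc l)
    then obtain m :: int where "x (Suc l) = x l + 2 * pi / real n + 2 * pi * m"
      using assms(1) by (auto simp: equispaced_def algebra_simps)
    then have "real j * x (Suc l) = real j * x l + 2 * pi * real j / real n + 2 * pi * of_int (int j * m)"
      by (simp add: algebra_simps)
    then have "cis (real j * x (Suc l)) = cis (real j * x l) * q * cis (2 * pi * of_int (int j * m))"
      by (simp only: q_def cis_mult)
    moreover have "cis (2 * pi * of_int (int j * m)) = 1" by (rule cis_multiple_2pi) simp
    moreover have "cis (real j * x l) = cis (real j * x 0) * q ^ l" using Suc by simp
    ultimately show ?case by simp
  qed simp
  have "(\<Sum>l<n. cis (real j * x l)) = cis (real j * x 0) * (\<Sum>l<n. q ^ l)"
    unfolding sum_distrib_left by (intro sum.cong refl pow) simp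
  moreover have "q \<noteq> 1"
  proof -
    have "0 < pi * real j / real n" "pi * real j / real n < pi"
      using assms by (auto simp: field_simps)
    then have "sin (pi * real j / real n) \<noteq> 0" using sin_gt_zero[of "pi * real j / real n"] by linarith
    moreover have "(2 * pi * real j / real n - 0) / 2 = pi * real j / real n" by simp
    ultimately have "sin ((2 * pi * real j / real n - 0) / 2) \<noteq> 0" by simp
    then show ?thesis unfolding q_def using cis_eq_iff_sin[of _ 0] by simp
  qed
  moreover have "q ^ n = 1"
    using assms cis_multiple_2pi[of "real j"] by (simp add: q_def Complex.DeMoivre)
  ultimately show ?thesis by (simp add: geometric_sum)
qed

lemma trapezoidal_exact:
  assumes "equispaced n x" "n > 0" "h \<in> trig_polys (n - 1)"
  shows "(h has_integral trapezoidal_sum n x h) {0..2 * pi}"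
  using assms(3)
proof (induction h rule: trig_polys_induct)
  case zero
  show ?case by (simp add: trapezoidal_sum_def)
next
  case (add f g)
  from has_integral_add[OF add.IH] show ?case
    by (simp add: trapezoidal_sum_def sum.distrib distrib_left)
next
  case (scale c f)
  from has_integral_mult_right[OF scale.IH, of c] show ?case
    by (simp add: trapezoidal_sum_def mult.left_commute flip: sum_distrib_left)
next
  case (cos j)
  show ?case
  proof (cases "j = 0")
    case True
    then show ?thesis using has_integral_const_real[of "1::real" 0 "2 * pi"] assms(2)
      by (simp add: trapezoidal_sum_def)
  next
    case False
    then have "Re (\<Sum>l<n. cis (real j * x l)) = 0"
      using cis_sum_equispaced[OF assms(1)] cos assms(2) by simp
    then show ?thesis
      using has_integral_linear[OF has_integral_cis_int[of "int j"] bounded_linear_Re] False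
      by (simp add: trapezoidal_sum_def o_def)
  qed
next
  case (sin j)
  show ?case
  proof (cases "j = 0")
    case True
    then show ?thesis by (simp add: trapezoidal_sum_def)
  next
    case False
    then have "Im (\<Sum>l<n. cis (real j * x l)) = 0"
      using cis_sum_equispaced[OF assms(1)] sin assms(2) by simp
    then show ?thesis
      using has_integral_linear[OF has_integral_cis_int[of "int j"] bounded_linear_Im] False
      by (simp add: trapezoidal_sum_def o_def)
  qed
qed

lemma trig_polys_integral_product:
  assumes "equispaced (2 * k + 1) x" "f \<in> trig_polys k" "g \<in> trig_polys k"
  shows "integral {0..2 * pi} (\<lambda>t. f t * g t) = trapezoidal_sum (2 * k + 1) x (\<lambda>t. f t * g t)"
proof -
  have "(\<lambda>t. f t * g t) \<in> trig_polys (2 * k + 1 - 1)"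
    using trig_polys_mult[OF assms(2,3)] by (simp add: mult_2)
  from trapezoidal_exact[OF assms(1) _ this] show ?thesis by (intro integral_unique) simp
qed

text \<open>
  A product of two elements of \<open>T\<^sub>k\<close> has degree at most \<open>2k = n - 1\<close>, where the trapezoidal rule is still
  exact.
\<close>

lemma is_trapezoidal_exact:
  fixes x :: "real ^ 'n" and W :: "real ^ 'n ^ 'n"
  assumes "CARD('n) = 2 * k + 1" "is_trapezoidal x W"
  shows "(x, W) \<in> exact_quads k"
proof -
  obtain p where p: "equispaced (2 * k + 1) (\<lambda>j. x $ p j)"
    "\<And>f g. periodic_fun_simple f (2 * pi) \<Longrightarrow> periodic_fun_simple g (2 * pi) \<Longrightarrow>
       bilinear_quad x W f g = trapezoidal_sum (2 * k + 1) (\<lambda>j. x $ p j) (\<lambda>t. f t * g t)"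
    using assms(2) unfolding is_trapezoidal_def assms(1) by blast
  have "bilinear_quad x W f g = integral {0..2 * pi} (\<lambda>t. f t * g t)"
    if "f \<in> trig_polys k" "g \<in> trig_polys k" for f g
    unfolding trig_polys_integral_product[OF p(1) that]
    by (rule p(2)) (use that trig_polys_periodic in blast)+
  then show ?thesis by (simp add: exact_quads_def)
qed

text \<open>
  On \<open>T\<^sub>k\<close> the \<open>L\<^sup>2\<close> inner product equals a trapezoidal sum over \<open>2k + 1\<close> points, which reduces the
  inequality to the one for finite sums.
\<close>

lemma trig_polys_Cauchy_Schwarz:
  assumes "f \<in> trig_polys k" "g \<in> trig_polys k"
  shows "\<bar>integral {0..2 * pi} (\<lambda>t. f t * g t)\<bar> \<le> L2norm f * L2norm g"
proof -
  define n where "n = 2 * k + 1"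
  define x where "x = (\<lambda>j. real j * (2 * pi / real n))"
  have x: "equispaced n x"
    unfolding equispaced_def x_def of_nat_add distrib_right by (intro allI impI exI[of _ 0]) simp
  define S where "S = (\<lambda>f g :: real \<Rightarrow> real. \<Sum>j<n. f (x j) * g (x j))"
  have I: "integral {0..2 * pi} (\<lambda>t. f t * g t) = 2 * pi / real n * S f g"
    if "f \<in> trig_polys k" "g \<in> trig_polys k" for f g
    using trig_polys_integral_product[OF x[unfolded n_def] that]
    by (simp add: S_def trapezoidal_sum_def n_def)
  have "(integral {0..2 * pi} (\<lambda>t. f t * g t))\<^sup>2 = (2 * pi / real n)\<^sup>2 * (S f g)\<^sup>2"
    unfolding I[OF assms] power_mult_distrib ..
  also have "(S f g)\<^sup>2 \<le> S f f * S g g"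
    using Cauchy_Schwarz_ineq_sum[of "\<lambda>j. f (x j)" "\<lambda>j. g (x j)" "{..<n}"]
    by (simp add: S_def power2_eq_square)
  then have "(2 * pi / real n)\<^sup>2 * (S f g)\<^sup>2 \<le> (2 * pi / real n)\<^sup>2 * (S f f * S g g)"
    by (intro mult_left_mono) auto
  also have "\<dots> = (L2norm f * L2norm g)\<^sup>2"
  proof -
    have *: "(L2norm h)\<^sup>2 = 2 * pi / real n * S h h" if "h \<in> trig_polys k" for h
      using I[OF that that] unfolding L2norm_square by (simp add: power2_eq_square)
    show ?thesis
      unfolding power_mult_distrib[of "L2norm f"] *[OF assms(1)] *[OF assms(2)]
      by (simp add: power2_eq_square)
  qed
  finally show ?thesis
    by (rule abs_le_square_iff[THEN iffD2, THEN order_trans]) (simp add: L2norm_nonneg)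
qed

section \<open>Interpolation at the nodes of an exact quadrature\<close>

lemma trig_polys_cis_cong:
  assumes "f \<in> trig_polys k" "cis s = cis t"
  shows "f s = f t"
proof -
  obtain p where p: "\<And>t. complex_of_real (f t) = laurent k p t"
    using trig_polys_laurent[OF assms(1)] by blast
  have "laurent k p t = cnj (cis t) ^ k * poly p (cis t)" for t
    by (simp add: laurent_def cis_cnj Complex.DeMoivre)
  then show ?thesis using p assms(2) by (metis of_real_eq_iff)
qed

text \<open>
  Each factor is \<open>e\<close> to the power \<open>-it/2\<close> times a linear polynomial in \<open>e\<^sup>i\<^sup>t\<close>. The half-integer exponents
  combine to \<open>-ikt\<close> because the number of factors is even.
\<close>

lemma sin_prod_laurent:
  fixes c :: "'a \<Rightarrow> real"
  assumes "finite A" "card A = 2 * k"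
  obtains p where "degree p \<le> 2 * k" "p \<noteq> 0"
    "\<And>t. complex_of_real (\<Prod>j\<in>A. sin ((t - c j) / 2)) = laurent k p t"
proof
  define q where "q = (\<lambda>j. smult (1 / (2 * \<i>)) [:- cis (c j / 2), cis (- (c j / 2)):])"
  show "prod q A \<noteq> 0" using assms(1) by (simp add: q_def)
  have "degree (prod q A) \<le> (\<Sum>j\<in>A. degree (q j))"
    by (rule order.trans[OF degree_prod_sum_le[OF assms(1)]]) (simp add: o_def)
  also have "\<dots> \<le> (\<Sum>j\<in>A. 1)" by (intro sum_mono) (simp add: q_def)
  finally show "degree (prod q A) \<le> 2 * k" using assms(2) by simp
  fix t
  have "complex_of_real (sin ((t - c j) / 2)) = cis (- (t / 2)) * poly (q j) (cis t)" for j
  proof -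
    have "cis (- (t / 2)) * (cis t * cis (- (c j / 2)) - cis (c j / 2)) =
        cis ((t - c j) / 2) - cis (- ((t - c j) / 2))"
    proof -
      have "- (t / 2) + (t + - (c j / 2)) = (t - c j) / 2" "- (t / 2) + c j / 2 = - ((t - c j) / 2)"
        by (simp_all add: field_simps)
      then show ?thesis by (simp only: right_diff_distrib cis_mult)
    qed
    also have "\<dots> = 2 * \<i> * sin ((t - c j) / 2)" by (simp add: complex_eq_iff)
    finally show ?thesis by (simp add: q_def field_simps)
  qed
  then have "complex_of_real (\<Prod>j\<in>A. sin ((t - c j) / 2)) =
      cis (- (t / 2)) ^ (2 * k) * poly (prod q A) (cis t)"
    by (simp add: prod.distrib poly_prod assms(2))
  also have "cis (- (t / 2)) ^ (2 * k) = cis (- (real k * t))"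
    by (simp add: Complex.DeMoivre)
  finally show "complex_of_real (\<Prod>j\<in>A. sin ((t - c j) / 2)) = laurent k (prod q A) t"
    by (simp add: laurent_def)
qed

lemma bilinear_quad_cong:
  assumes "\<And>i. f (x $ i) = f' (x $ i)" "\<And>i. g (x $ i) = g' (x $ i)"
  shows "bilinear_quad x W f g = bilinear_quad x W f' g'"
  using assms by (simp add: bilinear_quad_def)

text \<open>
  The product \<open>f\<close> of the functions \<open>sin ((t - x\<^sub>j) / 2)\<close> over \<open>j \<noteq> i\<close> has \<open>2k\<close> factors and so lies in
  \<open>T\<^sub>k\<close>. If it also vanished at \<open>x\<^sub>i\<close>, then \<open>Q(f, f) = 0\<close>, whereas by exactness \<open>Q(f, f)\<close> is the squared
  norm of a nonzero function. In particular, nodes that coincide on the circle are impossible.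
\<close>

lemma exact_quads_Lagrange:
  fixes x :: "real ^ 'n"
  assumes "(x, W) \<in> exact_quads k" "CARD('n) = 2 * k + 1"
  obtains l where "l \<in> trig_polys k" "l (x $ i) = 1" "\<And>j. j \<noteq> i \<Longrightarrow> l (x $ j) = 0"
proof -
  define f where "f = (\<lambda>t. \<Prod>j\<in>UNIV - {i}. sin ((t - x $ j) / 2))"
  have "card (UNIV - {i}) = 2 * k" using assms(2) by (simp add: card_Diff_singleton)
  from sin_prod_laurent[OF finite this, of "\<lambda>j. x $ j"]
  obtain p where p: "degree p \<le> 2 * k" "p \<noteq> 0" "\<And>t. complex_of_real (f t) = laurent k p t"
    unfolding f_def by blast
  have f: "f \<in> trig_polys k" using laurent_trig_polys p by blast
  have f0: "f (x $ j) = 0" if "j \<noteq> i" for j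
    unfolding f_def using that by (intro prod_zero bexI[of _ j]) auto
  have "f (x $ i) \<noteq> 0"
  proof
    assume "f (x $ i) = 0"
    then have "f (x $ j) = 0" for j using f0 by (cases "j = i") auto
    then have "bilinear_quad x W f f = 0" by (simp add: bilinear_quad_def inner_vec_def)
    then have "(L2norm f)\<^sup>2 = 0"
      using assms(1) f unfolding L2norm_square by (simp add: exact_quads_def power2_eq_square)
    then show False using laurent_L2norm_pos[OF p(2,3)] by simp
  qed
  then show thesis
    using that[of "\<lambda>t. inverse (f (x $ i)) * f t"] f0 trig_polys_scale[OF f] by simp
qed

lemma exact_quads_interpolate:
  fixes x :: "real ^ 'n" and u :: "'n \<Rightarrow> real"
  assumes "(x, W) \<in> exact_quads k" "CARD('n) = 2 * k + 1"
  obtains f where "f \<in> trig_polys k" "\<And>i. f (x $ i) = u i"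
proof -
  have "\<forall>i. \<exists>l. l \<in> trig_polys k \<and> l (x $ i) = 1 \<and> (\<forall>j. j \<noteq> i \<longrightarrow> l (x $ j) = 0)"
    using exact_quads_Lagrange[OF assms] by metis
  then obtain l where l: "\<And>i. l i \<in> trig_polys k" "\<And>i. l i (x $ i) = 1"
    "\<And>i j. j \<noteq> i \<Longrightarrow> l i (x $ j) = 0" by metis
  have "(\<Sum>i\<in>UNIV. u i * l i (x $ j)) = u j" for j
  proof -
    have "(\<Sum>i\<in>UNIV. u i * l i (x $ j)) = (\<Sum>i\<in>UNIV. if i = j then u i else 0)"
      using l by (intro sum.cong) auto
    then show ?thesis by simp
  qed
  moreover have "(\<lambda>t. \<Sum>i\<in>UNIV. u i * l i t) \<in> trig_polys k"
    by (intro trig_polys_sum trig_polys_scale l) auto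
  ultimately show thesis using that by blast
qed

lemma exact_quads_distinct:
  fixes x :: "real ^ 'n"
  assumes "(x, W) \<in> exact_quads k" "CARD('n) = 2 * k + 1"
  shows "inj (\<lambda>i. cis (x $ i))"
proof (rule injI, rule ccontr)
  fix i j assume "cis (x $ i) = cis (x $ j)" "i \<noteq> j"
  moreover obtain l where "l \<in> trig_polys k" "l (x $ i) = 1" "\<And>j. j \<noteq> i \<Longrightarrow> l (x $ j) = 0"
    using exact_quads_Lagrange[OF assms, of i] by blast
  ultimately show False using trig_polys_cis_cong[of l k "x $ i" "x $ j"] by simp
qed

text \<open>
  Exactness prescribes \<open>Q\<close> only on \<open>T\<^sub>k\<close>, but every function agrees at the nodes with an element of
  \<open>T\<^sub>k\<close>, and both sides depend on values at the nodes only.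
\<close>

lemma exact_equispaced_is_trapezoidal:
  fixes x :: "real ^ 'n"
  assumes "(x, W) \<in> exact_quads k" "CARD('n) = 2 * k + 1"
    and p: "bij_betw p {..<CARD('n)} (UNIV :: 'n set)" "equispaced CARD('n) (\<lambda>j. x $ p j)"
  shows "is_trapezoidal x W"
proof -
  have "bilinear_quad x W f g = trapezoidal_sum CARD('n) (\<lambda>j. x $ p j) (\<lambda>t. f t * g t)" for f g
  proof -
    obtain f' where f': "f' \<in> trig_polys k" "\<And>i. f' (x $ i) = f (x $ i)"
      using exact_quads_interpolate[OF assms(1,2), of "\<lambda>i. f (x $ i)"] by blast
    obtain g' where g': "g' \<in> trig_polys k" "\<And>i. g' (x $ i) = g (x $ i)"
      using exact_quads_interpolate[OF assms(1,2), of "\<lambda>i. g (x $ i)"] by blast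
    have "bilinear_quad x W f g = bilinear_quad x W f' g'"
      using f' g' by (intro bilinear_quad_cong) auto
    also have "\<dots> = integral {0..2 * pi} (\<lambda>t. f' t * g' t)"
      using assms(1) f' g' by (auto simp: exact_quads_def)
    also have "\<dots> = trapezoidal_sum CARD('n) (\<lambda>j. x $ p j) (\<lambda>t. f' t * g' t)"
      using trig_polys_integral_product[OF p(2)[unfolded assms(2)] f'(1) g'(1)]
      unfolding assms(2) .
    finally show ?thesis using f' g' by (simp add: trapezoidal_sum_def)
  qed
  then show ?thesis unfolding is_trapezoidal_def using p by blast
qed

lemma is_trapezoidal_exists:
  "\<exists>(x :: real ^ 'n) W. is_trapezoidal x W"
proof -
  define n where "n = CARD('n)"
  obtain p where p: "bij_betw p {..<n} (UNIV :: 'n set)"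
    using ex_bij_betw_nat_finite[of "UNIV :: 'n set"] by (auto simp: n_def atLeast0LessThan)
  define x :: "real ^ 'n" where "x = (\<chi> i. 2 * pi / real n * real (inv_into {..<n} p i))"
  define W :: "real ^ 'n ^ 'n" where "W = mat (2 * pi / real n)"
  have xp: "x $ p j = 2 * pi / real n * real j" if "j < n" for j
    using p that by (simp add: x_def bij_betw_inv_into_left)
  then have "equispaced n (\<lambda>j. x $ p j)"
    unfolding equispaced_def by (intro allI impI exI[of _ 0]) (simp add: distrib_left flip: diff_divide_distrib)
  moreover have "bilinear_quad x W f g = trapezoidal_sum n (\<lambda>j. x $ p j) (\<lambda>t. f t * g t)" for f g
  proof -
    have "bilinear_quad x W f g = (\<Sum>i\<in>UNIV. 2 * pi / real n * (f (x $ i) * g (x $ i)))"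
      by (simp add: bilinear_quad_def W_def matrix_vector_mult_def mat_def inner_vec_def
          if_distrib[of "\<lambda>z. z * _"] cong: if_cong) (simp add: mult_ac)
    also have "\<dots> = (\<Sum>j<n. 2 * pi / real n * (f (x $ p j) * g (x $ p j)))"
      by (rule sum.reindex_bij_betw[OF p, symmetric])
    finally show ?thesis by (simp add: trapezoidal_sum_def sum_distrib_left)
  qed
  ultimately show ?thesis using p unfolding is_trapezoidal_def n_def by blast
qed


section \<open>Interpolating the first frequency outside the space\<close>

text \<open>
  The real interpolants \<open>A\<close> and \<open>B\<close> of cosine and sine are packed into one complex polynomial \<open>p\<close>. Since
  \<open>\<bar>A + iB\<bar>\<^sup>2 = A\<^sup>2 + B\<^sup>2\<close>, Parseval for \<open>p\<close> gives the sum of both squared norms. Multiplying the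
  interpolation condition by \<open>e\<^sup>i\<^sup>k\<^sup>t\<close> raises the exponent from \<open>k + 1\<close> to \<open>2k + 1\<close>.
\<close>

lemma exact_quads_wave_interpolants:
  fixes x :: "real ^ 'n"
  assumes "(x, W) \<in> exact_quads k" "CARD('n) = 2 * k + 1"
  obtains A B p where "A \<in> trig_polys k" "B \<in> trig_polys k" "degree p \<le> 2 * k"
    "\<And>i. A (x $ i) = cos (real (k + 1) * x $ i)" "\<And>i. B (x $ i) = sin (real (k + 1) * x $ i)"
    "\<And>i. poly p (cis (x $ i)) = cis (x $ i) ^ (2 * k + 1)"
    "(L2norm A)\<^sup>2 + (L2norm B)\<^sup>2 = 2 * pi * (\<Sum>j\<le>2 * k. (cmod (coeff p j))\<^sup>2)"
proof -
  obtain A where A: "A \<in> trig_polys k" "\<And>i. A (x $ i) = cos (real (k + 1) * x $ i)"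
    using exact_quads_interpolate[OF assms, of "\<lambda>i. cos (real (k + 1) * x $ i)"] by blast
  obtain B where B: "B \<in> trig_polys k" "\<And>i. B (x $ i) = sin (real (k + 1) * x $ i)"
    using exact_quads_interpolate[OF assms, of "\<lambda>i. sin (real (k + 1) * x $ i)"] by blast
  obtain a where a: "degree a \<le> 2 * k" "\<And>t. complex_of_real (A t) = laurent k a t"
    using trig_polys_laurent[OF A(1)] by blast
  obtain b where b: "degree b \<le> 2 * k" "\<And>t. complex_of_real (B t) = laurent k b t"
    using trig_polys_laurent[OF B(1)] by blast
  define p where "p = a + smult \<i> b"
  have deg: "degree p \<le> 2 * k"
    unfolding p_def using a(1) b(1) by (intro degree_add_le) (auto intro: order.trans[OF degree_smult_le])
  have p: "laurent k p t = of_real (A t) + \<i> * of_real (B t)" for t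
    by (simp add: p_def laurent_add laurent_smult a(2) b(2))
  have "poly p (cis (x $ i)) = cis (x $ i) ^ (2 * k + 1)" for i
  proof -
    have "poly p (cis (x $ i)) = cis (real k * x $ i) * laurent k p (x $ i)"
      by (simp add: laurent_def cis_mult flip: mult.assoc)
    also have "laurent k p (x $ i) = cis (real (k + 1) * x $ i)"
      unfolding p A(2) B(2) by (simp add: complex_eq_iff)
    also have "cis (real k * x $ i) * cis (real (k + 1) * x $ i) = cis (x $ i) ^ (2 * k + 1)"
      unfolding Complex.DeMoivre cis_mult by (simp add: algebra_simps)
    finally show ?thesis .
  qed
  moreover have "(L2norm A)\<^sup>2 + (L2norm B)\<^sup>2 = 2 * pi * (\<Sum>j\<le>2 * k. (cmod (coeff p j))\<^sup>2)"
  proof -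
    have "(cmod (poly p (cis t)))\<^sup>2 = (A t)\<^sup>2 + (B t)\<^sup>2" for t
      unfolding norm_laurent[of k, symmetric] p by (simp add: cmod_power2)
    then have "((\<lambda>t. (A t)\<^sup>2 + (B t)\<^sup>2) has_integral 2 * pi * (\<Sum>j\<le>2 * k. (cmod (coeff p j))\<^sup>2)) {0..2 * pi}"
      using parseval_poly[OF deg] by simp
    moreover have "(\<lambda>t. (f t)\<^sup>2) integrable_on {0..2 * pi}" if "f \<in> trig_polys k" for f
      by (intro integrable_continuous_real continuous_on_power trig_polys_continuous[OF that])
    then have "integral {0..2 * pi} (\<lambda>t. (A t)\<^sup>2 + (B t)\<^sup>2) = (L2norm A)\<^sup>2 + (L2norm B)\<^sup>2"
      unfolding L2norm_square using A(1) B(1) by (intro Henstock_Kurzweil_Integration.integral_add)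
    ultimately show ?thesis by (simp add: integral_unique)
  qed
  ultimately show thesis using that A B deg by blast
qed

text \<open>
  The difference of \<open>z\<close> to the power \<open>card Z\<close> and \<open>p\<close> is monic of degree \<open>card Z\<close> and vanishes on \<open>Z\<close>, hence it is the product of
  the \<open>z - \<zeta>\<close> with \<open>\<zeta> \<in> Z\<close>. Comparing values at \<open>0\<close> expresses the constant coefficient of \<open>p\<close>
  as a product of numbers of modulus \<open>1\<close>.
\<close>

lemma cmod_coeff_0_power_interpolant:
  fixes p :: "complex poly"
  assumes "finite Z" "Z \<subseteq> sphere 0 1" "degree p < card Z" "\<And>z. z \<in> Z \<Longrightarrow> poly p z = z ^ card Z"
  shows "cmod (coeff p 0) = 1"
proof -
  define r where "r = monom 1 (card Z) - p"
  define d where "d = (\<Prod>z\<in>Z. [:- z, 1:])"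
  have deg_d: "degree d = card Z" by (simp add: d_def degree_prod_eq_sum_degree)
  have "r = d"
  proof (rule poly_eqI_degree_lead_coeff)
    show "coeff r (card Z) = coeff d (card Z)"
    proof -
      have "lead_coeff d = 1" by (simp add: d_def lead_coeff_prod)
      then show ?thesis using assms(3) by (simp add: r_def deg_d coeff_eq_0)
    qed
    show "degree r \<le> card Z"
      unfolding r_def using assms(3) by (intro degree_diff_le degree_monom_le) auto
    show "poly r z = poly d z" if "z \<in> Z" for z
    proof -
      have "poly d z = 0" unfolding d_def poly_prod using assms(1) that by (intro prod_zero) auto
      then show ?thesis using assms(4)[OF that] by (simp add: r_def poly_monom)
    qed
  qed (simp_all add: deg_d)
  then have "poly r 0 = poly d 0" by simp
  moreover have "poly r 0 = - coeff p 0"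
    using assms(3) by (simp add: r_def poly_monom poly_0_coeff_0)
  moreover have "cmod (poly d 0) = 1"
    using assms(2) by (auto simp: d_def poly_prod prod_norm[symmetric] intro!: prod.neutral)
  ultimately show ?thesis by (metis norm_minus_cancel)
qed

text \<open>
  Dividing by one of the nodes gives \<open>n\<close> distinct \<open>n\<close>-th roots of unity, hence all of them; the
  required ordering of the nodes is that of the roots of unity by argument.
\<close>

lemma equispaced_of_power_eq:
  fixes x :: "real ^ 'n"
  assumes "inj (\<lambda>i. cis (x $ i))" "\<And>i. cis (x $ i) ^ CARD('n) = c"
  obtains p where "bij_betw p {..<CARD('n)} (UNIV :: 'n set)" "equispaced CARD('n) (\<lambda>j. x $ p j)"
proof -
  define n where "n = CARD('n)"
  define i0 :: 'n where "i0 = undefined"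
  define r where "r = (\<lambda>i. cis (x $ i - x $ i0))"
  define root where "root = (\<lambda>j. cis (2 * pi * real j / real n))"
  have n: "n > 0" by (simp add: n_def)
  have root: "bij_betw root {..<n} {z. z ^ n = 1}"
    unfolding root_def by (rule Complex.bij_betw_roots_unity[OF n])
  have r_div: "r i = cis (x $ i) / cis (x $ i0)" for i by (simp add: r_def cis_divide)
  have "inj r" using assms(1) by (simp add: inj_def r_div)
  moreover have "range r = {z. z ^ n = 1}"
  proof (rule card_subset_eq)
    show "finite {z::complex. z ^ n = 1}" using bij_betw_finite[OF root] by simp
    have "cis (x $ i) ^ n = cis (x $ i0) ^ n" for i using assms(2) by (simp add: n_def)
    then show "range r \<subseteq> {z. z ^ n = 1}" by (auto simp: r_div power_divide)
    show "card (range r) = card {z::complex. z ^ n = 1}"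
      using card_image[OF \<open>inj r\<close>] bij_betw_same_card[OF root] by (simp add: n_def)
  qed
  ultimately have r: "bij_betw r UNIV {z. z ^ n = 1}" by (simp add: bij_betw_def)
  define p where "p = inv r \<circ> root"
  have p: "bij_betw p {..<n} UNIV"
    unfolding p_def by (rule bij_betw_trans[OF root bij_betw_inv_into[OF r]])
  have rp: "r (p j) = root j" if "j < n" for j
    unfolding p_def o_def using bij_betw_inv_into_right[OF r] bij_betw_apply[OF root] that by simp
  have "equispaced n (\<lambda>j. x $ p j)"
    unfolding equispaced_def
  proof (intro allI impI)
    fix j assume j: "j + 1 < n"
    have "cis (x $ p (j + 1) - x $ p j) = r (p (j + 1)) / r (p j)"
      by (simp add: r_def cis_divide)
    also have "\<dots> = root (j + 1) / root j" using rp j by simp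
    also have "\<dots> = cis (2 * pi / real n)"
      by (simp add: root_def cis_divide distrib_left flip: diff_divide_distrib)
    finally have "sin (x $ p (j + 1) - x $ p j) = sin (2 * pi / real n)"
      "cos (x $ p (j + 1) - x $ p j) = cos (2 * pi / real n)" by (simp_all add: complex_eq_iff)
    then show "\<exists>m::int. x $ p (j + 1) - x $ p j = 2 * pi / real n + 2 * pi * of_int m"
      using sin_cos_eq_iff by blast
  qed
  then show thesis using that p by (simp add: n_def)
qed

section \<open>The functional \<open>\<sigma>\<close> as an interpolation norm\<close>

lemma span_eq_range_wave:
  "fspace.span {\<lambda>x. sin ((real n + 1) * x / 2), \<lambda>x. cos ((real n + 1) * x / 2)} = range (wave (k + 1))"
  if "n = 2 * k + 1"
proof -
  have half: "(real n + 1) * t / 2 = real (k + 1) * t" for t using that by simp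
  let ?S = "{\<lambda>x. sin (real (k + 1) * x), \<lambda>x. cos (real (k + 1) * x)}"
  have "fspace.span ?S = range (wave (k + 1))"
  proof (intro equalityI subsetI)
    fix f assume "f \<in> fspace.span ?S"
    then show "f \<in> range (wave (k + 1))"
    proof (rule fspace.span_induct)
      show "fspace.subspace {f. f \<in> range (wave (k + 1))}"
        unfolding fspace.subspace_def
      proof (safe)
        show "0 \<in> range (wave (k + 1))" by (rule image_eqI[of _ _ 0]) (auto simp: wave_def)
      next
        fix v w show "wave (k + 1) v + wave (k + 1) w \<in> range (wave (k + 1))"
          by (rule image_eqI[of _ _ "v + w"]) (auto simp: wave_def algebra_simps fun_eq_iff)
      next
        fix c w show "(\<lambda>t. c * wave (k + 1) w t) \<in> range (wave (k + 1))"
          by (rule image_eqI[of _ _ "of_real c * w"]) (auto simp: wave_def algebra_simps fun_eq_iff)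
      qed
      fix f assume "f \<in> ?S"
      then show "f \<in> range (wave (k + 1))"
      proof (elim insertE emptyE)
        assume "f = (\<lambda>x. sin (real (k + 1) * x))"
        then show ?thesis by (intro image_eqI[of _ _ "- \<i>"]) (auto simp: wave_def fun_eq_iff)
      next
        assume "f = (\<lambda>x. cos (real (k + 1) * x))"
        then show ?thesis by (intro image_eqI[of _ _ 1]) (auto simp: wave_def fun_eq_iff)
      qed
    qed
  next
    fix f assume "f \<in> range (wave (k + 1))"
    then obtain w where f: "f = wave (k + 1) w" by blast
    have "(\<lambda>t. Re w * cos (real (k + 1) * t)) + (\<lambda>t. - Im w * sin (real (k + 1) * t)) \<in> fspace.span ?S"
      by (intro fspace.span_add fspace.span_scale fspace.span_base) auto
    also have "(\<lambda>t. Re w * cos (real (k + 1) * t)) + (\<lambda>t. - Im w * sin (real (k + 1) * t)) = f"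
      by (simp add: f fun_eq_iff wave_cos_sin)
    finally show "f \<in> fspace.span ?S" .
  qed
  then show ?thesis by (simp only: half)
qed

lemma wave_eq_0_iff: "m > 0 \<Longrightarrow> wave m w = 0 \<longleftrightarrow> w = 0"
proof
  assume "m > 0" "wave m w = 0"
  then have "sqrt pi * cmod w = 0" using L2norm_wave[of m w] by (simp add: L2norm_def)
  then show "w = 0" by simp
qed (simp add: wave_def fun_eq_iff)

text \<open>
  The point is that the quotients are bounded; otherwise \<^const>\<open>Sup\<close> would carry no information. By
  linearity it suffices to bound \<open>Q(f, A)\<close> and \<open>Q(f, B)\<close> for the interpolants \<open>A\<close> and \<open>B\<close> of cosine and sine,
  and these are integrals.
\<close>

lemma quad_ratio_le_sigma:
  fixes x :: "real ^ 'n"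
  assumes "(x, W) \<in> exact_quads k" "CARD('n) = 2 * k + 1"
    and "f \<in> trig_polys k" "f \<noteq> 0" "w \<noteq> 0"
  shows "\<bar>bilinear_quad x W f (wave (k + 1) w)\<bar> / (L2norm f * (sqrt pi * cmod w))
    \<le> quad_sigma k (range (wave (k + 1))) x W"
proof -
  obtain A B where AB: "A \<in> trig_polys k" "B \<in> trig_polys k"
    "\<And>i. A (x $ i) = cos (real (k + 1) * x $ i)" "\<And>i. B (x $ i) = sin (real (k + 1) * x $ i)"
    using exact_quads_wave_interpolants[OF assms(1,2)] by metis
  let ?R = "\<lambda>f g. \<bar>bilinear_quad x W f g\<bar> / (L2norm f * L2norm g)"
  have bound: "?R f (wave (k + 1) v) \<le> (L2norm A + L2norm B) / sqrt pi"
    if f: "f \<in> trig_polys k" "f \<noteq> 0" and v: "v \<noteq> 0" for f v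
  proof -
    define h where "h = (\<lambda>t. Re v * A t + (- Im v) * B t)"
    have I: "\<bar>bilinear_quad x W f g\<bar> \<le> L2norm f * L2norm g" if "g \<in> trig_polys k" for g
      using trig_polys_Cauchy_Schwarz[OF f(1) that] assms(1) f(1) that by (simp add: exact_quads_def)
    have lin: "bilinear_quad x W f (wave (k + 1) v)
        = Re v * bilinear_quad x W f A - Im v * bilinear_quad x W f B"
      by (simp add: bilinear_quad_def AB wave_cos_sin inner_vec_def matrix_vector_mult_def
          sum_distrib_left sum_subtractf algebra_simps)
    have "\<bar>bilinear_quad x W f (wave (k + 1) v)\<bar>
        \<le> \<bar>Re v\<bar> * \<bar>bilinear_quad x W f A\<bar> + \<bar>Im v\<bar> * \<bar>bilinear_quad x W f B\<bar>"
      unfolding lin abs_mult[symmetric] by (rule abs_triangle_ineq4)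
    also have "\<dots> \<le> cmod v * (L2norm f * L2norm A) + cmod v * (L2norm f * L2norm B)"
      by (intro add_mono mult_mono I AB abs_Re_le_cmod abs_Im_le_cmod) auto
    also have "\<dots> = (L2norm A + L2norm B) / sqrt pi * (L2norm f * (sqrt pi * cmod v))"
      by (simp add: field_simps)
    finally show ?thesis
      using trig_polys_L2norm_pos[OF f] v by (simp add: L2norm_wave divide_le_eq)
  qed
  have "?R f (wave (k + 1) w) \<le> quad_sigma k (range (wave (k + 1))) x W"
    unfolding quad_sigma_def
  proof (rule cSup_upper)
    show "?R f (wave (k + 1) w) \<in> {?R f g |f g. f \<in> trig_polys k \<and> f \<noteq> 0 \<and> g \<in> range (wave (k + 1)) \<and> g \<noteq> 0}"
      using assms(3-5) wave_eq_0_iff[of "k + 1" w] by auto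
    show "bdd_above {?R f g |f g. f \<in> trig_polys k \<and> f \<noteq> 0 \<and> g \<in> range (wave (k + 1)) \<and> g \<noteq> 0}"
    proof (rule bdd_aboveI)
      fix r assume "r \<in> {?R f g |f g. f \<in> trig_polys k \<and> f \<noteq> 0 \<and> g \<in> range (wave (k + 1)) \<and> g \<noteq> 0}"
      then obtain f v where "r = ?R f (wave (k + 1) v)" "f \<in> trig_polys k" "f \<noteq> 0" "wave (k + 1) v \<noteq> 0"
        by blast
      then show "r \<le> (L2norm A + L2norm B) / sqrt pi"
        using bound[of f v] wave_eq_0_iff[of "k + 1" v] by simp
    qed
  qed
  then show ?thesis by (simp add: L2norm_wave)
qed

lemma one_nonzero: "(\<lambda>t. 1 :: real) \<noteq> (0 :: real \<Rightarrow> real)"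
  by (simp add: fun_eq_iff)

text \<open>
  Testing \<open>\<sigma>\<close> with the interpolant \<open>h\<close> itself in the first argument gives the quotient
  \<open>\<parallel>h\<parallel>\<^sup>2 / (\<parallel>h\<parallel> \<parallel>g\<parallel>)\<close>, where \<open>g\<close> is the wave that \<open>h\<close> interpolates.
\<close>

lemma interpolant_norm_le_sigma:
  fixes x :: "real ^ 'n"
  assumes "(x, W) \<in> exact_quads k" "CARD('n) = 2 * k + 1"
    and h: "h \<in> trig_polys k" "\<And>i. h (x $ i) = wave (k + 1) w (x $ i)" and "w \<noteq> 0"
  shows "L2norm h \<le> sqrt pi * cmod w * quad_sigma k (range (wave (k + 1))) x W"
    (is "_ \<le> _ * ?s")
proof (cases "h = 0")
  case True
  have "0 \<le> \<bar>bilinear_quad x W (\<lambda>t. 1) (wave (k + 1) w)\<bar> / (L2norm (\<lambda>t. 1) * (sqrt pi * cmod w))"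
    by (simp add: L2norm_nonneg)
  also have "\<dots> \<le> ?s"
    by (rule quad_ratio_le_sigma[OF assms(1,2) trig_polys_const one_nonzero assms(5)])
  finally show ?thesis using True by (simp add: L2norm_def)
next
  case False
  have "bilinear_quad x W h (wave (k + 1) w) = bilinear_quad x W h h"
    using h(2) by (intro bilinear_quad_cong) auto
  also have "\<dots> = (L2norm h)\<^sup>2"
    using assms(1) h(1) unfolding L2norm_square by (simp add: exact_quads_def power2_eq_square)
  finally have "(L2norm h)\<^sup>2 / (L2norm h * (sqrt pi * cmod w)) \<le> ?s"
    using quad_ratio_le_sigma[OF assms(1,2) h(1) False assms(5)] by simp
  then show ?thesis
    using trig_polys_L2norm_pos[OF h(1) False] assms(5) by (simp add: power2_eq_square field_simps)
qed

section \<open>The minimum and the minimizers\<close>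

text \<open>
  The value is exceptional for \<open>k = 0\<close> because a constant function of modulus \<open>1\<close> has squared norm
  \<open>2\<pi>\<close>, whereas a wave of positive frequency and amplitude \<open>1\<close> has squared norm \<open>\<pi>\<close>.
\<close>

definition sigma_min :: "nat \<Rightarrow> real" where
  "sigma_min k = (if k = 0 then sqrt 2 else 1)"

lemma L2norm_wave_le: "L2norm (wave k w) \<le> sigma_min k * (sqrt pi * cmod w)"
proof (cases "k = 0")
  case True
  have "integral {0..2 * pi} (\<lambda>t. (wave 0 w t)\<^sup>2) = 2 * pi * (Re w)\<^sup>2"
    by (simp add: wave_def)
  then have "L2norm (wave 0 w) = sqrt 2 * (sqrt pi * \<bar>Re w\<bar>)"
    by (simp add: L2norm_def real_sqrt_mult)
  then show ?thesis using True abs_Re_le_cmod[of w] by (simp add: sigma_min_def)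
qed (simp add: L2norm_wave sigma_min_def)

lemma cis_power_equispaced:
  assumes "equispaced n x" "j < n"
  shows "cis (x j) ^ n = cis (x 0) ^ n"
  using assms(2)
proof (induction j)
  case (Suc j)
  then obtain m :: int where m: "x (Suc j) = x j + 2 * pi / real n + 2 * pi * of_int m"
    using assms(1) by (auto simp: equispaced_def algebra_simps)
  have "real n * x (Suc j) = real n * x j + 2 * pi * of_int (1 + int n * m)"
    using Suc.prems unfolding m by (simp add: field_simps)
  then have "cis (x (Suc j)) ^ n = cis (x j) ^ n * cis (2 * pi * of_int (1 + int n * m))"
    by (simp only: Complex.DeMoivre cis_mult)
  also have "cis (2 * pi * of_int (1 + int n * m)) = 1" by (rule cis_multiple_2pi) simp
  finally show ?case using Suc by simp
qed simp

text \<open>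
  All nodes have the same \<open>n\<close>-th power \<open>c\<close> on the unit circle. Hence \<open>z\<close> to the power \<open>k + 1\<close> equals
  \<open>c\<close> times \<open>z\<close> to the power \<open>-k\<close> at every node, and conjugation brings the exponent \<open>-k\<close> to \<open>k\<close>.
\<close>

lemma trapezoidal_alias:
  fixes x :: "real ^ 'n"
  assumes "is_trapezoidal x W" "CARD('n) = 2 * k + 1"
  obtains v where "cmod v = cmod w" "\<And>i. wave k v (x $ i) = wave (k + 1) w (x $ i)"
proof -
  obtain p where p: "bij_betw p {..<CARD('n)} (UNIV :: 'n set)" "equispaced CARD('n) (\<lambda>j. x $ p j)"
    using assms(1) unfolding is_trapezoidal_def by blast
  define c where "c = cis (x $ p 0) ^ (2 * k + 1)"
  have c: "cis (x $ i) ^ (2 * k + 1) = c" for i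
  proof -
    obtain j where "j < CARD('n)" "i = p j" using p(1) unfolding bij_betw_def by (metis UNIV_I imageE lessThan_iff)
    then show ?thesis
      unfolding c_def using cis_power_equispaced[OF p(2), of j, unfolded assms(2)] assms(2) by simp
  qed
  have "wave k (cnj (w * c)) (x $ i) = wave (k + 1) w (x $ i)" for i
  proof -
    have "wave k (cnj (w * c)) (x $ i) = Re (cnj (cnj (w * c) * cis (real k * x $ i)))"
      by (simp only: wave_def cnj.sel)
    also have "cnj (cnj (w * c) * cis (real k * x $ i)) =
        w * (cis (x $ i) ^ (2 * k + 1) * cis (- (real k * x $ i)))"
      unfolding complex_cnj_mult complex_cnj_cnj cis_cnj c[of i] by (simp add: mult.assoc)
    also have "cis (x $ i) ^ (2 * k + 1) * cis (- (real k * x $ i)) = cis (real (k + 1) * x $ i)"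
      unfolding Complex.DeMoivre cis_mult by (simp add: algebra_simps)
    finally show ?thesis by (simp only: wave_def)
  qed
  moreover have "cmod (cnj (w * c)) = cmod w" by (simp add: c_def norm_mult norm_power)
  ultimately show thesis using that by blast
qed

lemma sigma_trapezoidal_le:
  fixes x :: "real ^ 'n"
  assumes "is_trapezoidal x W" "CARD('n) = 2 * k + 1"
  shows "quad_sigma k (range (wave (k + 1))) x W \<le> sigma_min k"
  unfolding quad_sigma_def
proof (rule cSup_least)
  have "wave (k + 1) 1 \<noteq> 0" using wave_eq_0_iff[of "k + 1" 1] by simp
  then show "{\<bar>bilinear_quad x W f g\<bar> / (L2norm f * L2norm g) |f g.
      f \<in> trig_polys k \<and> f \<noteq> 0 \<and> g \<in> range (wave (k + 1)) \<and> g \<noteq> 0} \<noteq> {}"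
    using trig_polys_const[of k] one_nonzero by blast
next
  fix r assume "r \<in> {\<bar>bilinear_quad x W f g\<bar> / (L2norm f * L2norm g) |f g.
      f \<in> trig_polys k \<and> f \<noteq> 0 \<and> g \<in> range (wave (k + 1)) \<and> g \<noteq> 0}"
  then obtain f w where f: "f \<in> trig_polys k" "f \<noteq> 0" and "wave (k + 1) w \<noteq> 0"
    and r: "r = \<bar>bilinear_quad x W f (wave (k + 1) w)\<bar> / (L2norm f * L2norm (wave (k + 1) w))"
    by blast
  then have w: "w \<noteq> 0" using wave_eq_0_iff[of "k + 1" w] by simp
  obtain v where v: "cmod v = cmod w" "\<And>i. wave k v (x $ i) = wave (k + 1) w (x $ i)"
    using trapezoidal_alias[OF assms] by blast
  have "bilinear_quad x W f (wave (k + 1) w) = bilinear_quad x W f (wave k v)"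
    using v(2) by (intro bilinear_quad_cong) auto
  also have "\<dots> = integral {0..2 * pi} (\<lambda>t. f t * wave k v t)"
    using is_trapezoidal_exact[OF assms(2,1)] f(1) wave_trig_polys[of k k v]
    by (simp add: exact_quads_def)
  finally have "\<bar>bilinear_quad x W f (wave (k + 1) w)\<bar> \<le> L2norm f * L2norm (wave k v)"
    using trig_polys_Cauchy_Schwarz[OF f(1) wave_trig_polys[of k k v]] by simp
  also have "\<dots> \<le> L2norm f * (sigma_min k * (sqrt pi * cmod w))"
    using L2norm_wave_le[of k v] by (intro mult_left_mono L2norm_nonneg) (simp add: v(1))
  also have "\<dots> = sigma_min k * (L2norm f * L2norm (wave (k + 1) w))"
    by (simp add: L2norm_wave)
  finally show "r \<le> sigma_min k"
    unfolding r using trig_polys_L2norm_pos[OF f] w by (simp add: L2norm_wave divide_le_eq)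
qed

text \<open>
  For \<open>k > 0\<close> both parts come from the chain
  \<open>2\<pi> \<le> 2\<pi> \<Sum>\<^sub>j \<bar>p\<^sub>j\<bar>\<^sup>2 = \<parallel>A\<parallel>\<^sup>2 + \<parallel>B\<parallel>\<^sup>2 \<le> 2\<pi>\<sigma>\<^sup>2\<close>, with equality only if all coefficients of \<open>p\<close> except
  the constant one vanish. For \<open>k = 0\<close> the polynomial \<open>p\<close> is constant anyway, and the bound \<open>\<surd>2\<close> comes from the
  wave whose crest is at the single node.
\<close>

lemma
  fixes x :: "real ^ 'n"
  assumes "(x, W) \<in> exact_quads k" "CARD('n) = 2 * k + 1"
  defines "s \<equiv> quad_sigma k (range (wave (k + 1))) x W"
  shows sigma_ge_sigma_min: "sigma_min k \<le> s"
    and sigma_eq_min_imp_trapezoidal: "s \<le> sigma_min k \<Longrightarrow> is_trapezoidal x W"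
proof -
  obtain A B p where AB: "A \<in> trig_polys k" "B \<in> trig_polys k"
    and deg: "degree p \<le> 2 * k"
    and A: "\<And>i. A (x $ i) = cos (real (k + 1) * x $ i)"
    and B: "\<And>i. B (x $ i) = sin (real (k + 1) * x $ i)"
    and p: "\<And>i. poly p (cis (x $ i)) = cis (x $ i) ^ (2 * k + 1)"
    and energy: "(L2norm A)\<^sup>2 + (L2norm B)\<^sup>2 = 2 * pi * (\<Sum>j\<le>2 * k. (cmod (coeff p j))\<^sup>2)"
    using exact_quads_wave_interpolants[OF assms(1,2)] by blast
  define Z where "Z = range (\<lambda>i. cis (x $ i))"
  have inj: "inj (\<lambda>i. cis (x $ i))" by (rule exact_quads_distinct[OF assms(1,2)])
  then have card_Z: "card Z = 2 * k + 1" using assms(2) by (simp add: Z_def card_image)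
  have "cmod (coeff p 0) = 1"
    by (rule cmod_coeff_0_power_interpolant[of Z]) (use p deg card_Z in \<open>auto simp: Z_def\<close>)
  moreover have "{..2 * k} = insert 0 {1..2 * k}" by auto
  ultimately have split: "(\<Sum>j\<le>2 * k. (cmod (coeff p j))\<^sup>2) = 1 + (\<Sum>j=1..2 * k. (cmod (coeff p j))\<^sup>2)"
    by simp
  \<comment> \<open>The phases \<open>1\<close> and \<open>-\<i>\<close> turn the wave of frequency \<open>k + 1\<close> into cosine and sine.\<close>
  have "L2norm A \<le> sqrt pi * s" "L2norm B \<le> sqrt pi * s"
    using interpolant_norm_le_sigma[OF assms(1,2) AB(1), of 1]
      interpolant_norm_le_sigma[OF assms(1,2) AB(2), of "- \<i>"]
    by (simp_all add: A B wave_cos_sin s_def)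
  then have "(L2norm A)\<^sup>2 \<le> pi * s\<^sup>2" "(L2norm B)\<^sup>2 \<le> pi * s\<^sup>2"
    using power_mono[of _ "sqrt pi * s" 2] L2norm_nonneg by (fastforce simp: power_mult_distrib)+
  then have "2 * pi * (\<Sum>j\<le>2 * k. (cmod (coeff p j))\<^sup>2) \<le> 2 * pi * s\<^sup>2"
    unfolding energy[symmetric] by linarith
  then have sum_le: "1 + (\<Sum>j=1..2 * k. (cmod (coeff p j))\<^sup>2) \<le> s\<^sup>2"
    unfolding split by simp
  have "0 \<le> sqrt pi * s"
    using \<open>L2norm A \<le> sqrt pi * s\<close> L2norm_nonneg[of A] by linarith
  then have "s \<ge> 0" using pi_gt_zero by (auto simp: zero_le_mult_iff)
  show "sigma_min k \<le> s"
  proof (cases "k = 0")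
    case False
    have "1 \<le> s\<^sup>2" using sum_le sum_nonneg[of "{1..2 * k}" "\<lambda>j. (cmod (coeff p j))\<^sup>2"] by simp
    then show ?thesis using False \<open>s \<ge> 0\<close> power2_le_imp_le[of 1 s] by (simp add: sigma_min_def)
  next
    case True
    define y where "y = x $ undefined"
    have "CARD('n) = 1" using True assms(2) by simp
    then have "x $ i = y" for i by (metis (full_types) UNIV_I card_1_singletonE singletonD y_def)
    \<comment> \<open>The phase \<open>-y\<close> puts the crest of the wave at the node, where it is interpolated by \<open>1\<close>.\<close>
    then have "wave (k + 1) (cis (- y)) (x $ i) = 1" for i
      using True by (simp add: wave_def cis_mult)
    then have "L2norm (\<lambda>t. 1) \<le> sqrt pi * s"
      using interpolant_norm_le_sigma[OF assms(1,2) trig_polys_const, of "cis (- y)"] by (simp add: s_def)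
    then show ?thesis using True by (simp add: L2norm_def sigma_min_def real_sqrt_mult)
  qed
  show "is_trapezoidal x W" if "s \<le> sigma_min k"
  proof -
    have "coeff p j = 0" if j: "j > 0" for j
    proof (cases "j \<le> 2 * k")
      case True
      then have "sigma_min k = 1" using j by (auto simp: sigma_min_def)
      then have "s\<^sup>2 \<le> 1" using \<open>s \<le> sigma_min k\<close> \<open>s \<ge> 0\<close> by (simp add: power_le_one)
      then have "(\<Sum>j=1..2 * k. (cmod (coeff p j))\<^sup>2) = 0"
        using sum_le sum_nonneg[of "{1..2 * k}" "\<lambda>j. (cmod (coeff p j))\<^sup>2"] by simp
      then show ?thesis using True j by (simp add: sum_nonneg_eq_0_iff)
    qed (use deg in \<open>simp add: coeff_eq_0\<close>)
    then have "degree p = 0" by (metis leading_coeff_0_iff degree_0 gr0I)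
    then obtain c where "p = [:c:]" by (rule degree_eq_zeroE)
    then have "cis (x $ i) ^ CARD('n) = c" for i using p[of i] assms(2) by simp
    then obtain q where "bij_betw q {..<CARD('n)} (UNIV :: 'n set)" "equispaced CARD('n) (\<lambda>j. x $ q j)"
      using equispaced_of_power_eq[OF inj] by blast
    then show ?thesis using exact_equispaced_is_trapezoidal[OF assms(1,2)] by blast
  qed
qed

theorem theorem2p14:
  fixes n k :: nat and G :: "(real \<Rightarrow> real) set"
  assumes "n = CARD('n::finite)" and "odd n"
    and "k = (n - 1) div 2"
    and "G = fspace.span {\<lambda>x. sin ((real n + 1) * x / 2), \<lambda>x. cos ((real n + 1) * x / 2)}"
  shows "(\<forall>x. equispaced n x \<longrightarrow>
            (\<forall>h\<in>trig_polys (n - 1). integral {0..2*pi} h = trapezoidal_sum n x h)) \<and>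
         (\<forall>(x :: real ^ 'n) W. is_trapezoidal x W \<longrightarrow> (x, W) \<in> exact_quads k) \<and>
         (\<forall>(x :: real ^ 'n) W. (x, W) \<in> exact_quads k \<longrightarrow>
            (minimal_quad k G x W \<longleftrightarrow> is_trapezoidal x W))"
proof -
  have n: "n = 2 * k + 1" using assms(2,3) by (auto elim!: oddE)
  have card: "CARD('n) = 2 * k + 1" using assms(1) n by simp
  have G: "G = range (wave (k + 1))" unfolding assms(4) by (rule span_eq_range_wave[OF n])
  have "minimal_quad k G x W \<longleftrightarrow> is_trapezoidal x W" if ex: "(x, W) \<in> exact_quads k"
    for x :: "real ^ 'n" and W
  proof
    assume min: "minimal_quad k G x W"
    obtain y :: "real ^ 'n" and V where yV: "is_trapezoidal y V" using is_trapezoidal_exists by blast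
    have "quad_sigma k G x W \<le> quad_sigma k G y V"
      using min is_trapezoidal_exact[OF card yV] unfolding minimal_quad_def by blast
    also have "\<dots> \<le> sigma_min k" unfolding G by (rule sigma_trapezoidal_le[OF yV card])
    finally show "is_trapezoidal x W" unfolding G by (rule sigma_eq_min_imp_trapezoidal[OF ex card])
  next
    assume "is_trapezoidal x W"
    then have "quad_sigma k G x W \<le> sigma_min k"
      unfolding G by (rule sigma_trapezoidal_le[OF _ card])
    moreover have "sigma_min k \<le> quad_sigma k G y V" if "(y, V) \<in> exact_quads k"
      for y :: "real ^ 'n" and V
      unfolding G by (rule sigma_ge_sigma_min[OF that card])
    ultimately have "quad_sigma k G x W \<le> quad_sigma k G y V" if "(y, V) \<in> exact_quads k"
      for y :: "real ^ 'n" and V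
      using that by (meson order.trans)
    then show "minimal_quad k G x W" using ex by (auto simp: minimal_quad_def)
  qed
  moreover have "integral {0..2*pi} h = trapezoidal_sum n x h"
    if "equispaced n x" "h \<in> trig_polys (n - 1)" for x h
    using trapezoidal_exact[OF that(1) _ that(2)] n by (intro integral_unique) simp
  ultimately show ?thesis using is_trapezoidal_exact[OF card] by blast
qed

end
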